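(* Let $k,n\ge1$, let $S_n$ act on $[k]^n$ by $(g\cdot x)_i=x_{g^{-1}(i)}$, and let $Q$ be the dual Burnside kernel on $S_n$. For $g,h\in S_n$ let $O_1,\dots,O_s$ be the orbits of $\langle g,h\rangle$ on $[n]$, with sizes $b_j:=|O_j|$, and let $c(g)$ be the number of cycles of $g$ (including fixed points). For $\phi:[s]\to[k]$ set $M_a(\phi):=\sum_{j:\phi(j)=a}b_j$, $a=1,\dots,k$. Then $$Q(g,h)=\frac1{k^{c(g)}}\sum_{\phi:[s]\to[k]}\prod_{a=1}^k\frac1{M_a(\phi)!}=\frac{k^{-c(g)}}{n!}\sum_{\phi:[s]\to[k]}\binom n{M_1(\phi),\dots,M_k(\phi)}=k^{s-c(g)}\,\mathbb E\left[\prod_{a=1}^k\frac1{M_a!}\right],$$ where $M_a=\sum_{j=1}^sb_j\mathbf 1_{\{U_j=a\}}$ and $U_1,\dots,U_s$ are i.i.d. uniform on $[k]$. Also, $$Q(g,h)=\frac1{k^{c(g)}}[z_1^0\cdots z_k^0]\exp\left(\sum_{a=1}^kz_a\right)\prod_{j=1}^s\sum_{a=1}^kz_a^{-b_j}=k^{-c(g)}[z_1^0\cdots z_k^0]\frac{(z_1+\cdots+z_k)^n}{n!}\prod_{j=1}^s\sum_{a=1}^kz_a^{-b_j}.$$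
   Context: $[m]=\{1,\dots,m\}$. For the action of $G=S_n$ on $X=[k]^n$: $X_g=\{x\in X:g\cdot x=x\}$, $G_x=\{g\in G:g\cdot x=x\}$; every $g\in S_n$ fixes the constant words, so the dual Burnside kernel is defined on all of $S_n$ by $Q(g,h)=\frac1{|X_g|}\sum_{x\in X_g\cap X_h}\frac1{|G_x|}$. $[z_1^0\cdots z_k^0]$ denotes extraction of the constant term. *)

theory Defs
  imports
    "HOL-Algebra.Sym_Groups"
    "HOL-Algebra.Group_Action"
    "HOL-Combinatorics.Orbits"
    "HOL-Library.Poly_Mapping"
    "HOL-Probability.Probability"
begin

definition dual_burnside ::
    "('a, 'm) monoid_scheme \<Rightarrow> 'b set \<Rightarrow> ('a \<Rightarrow> 'b \<Rightarrow> 'b) \<Rightarrow> 'a \<Rightarrow> 'a \<Rightarrow> real" where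
  "dual_burnside G X \<phi> g h =
     1 / real (card (invariants X \<phi> g)) *
     (\<Sum>x \<in> invariants X \<phi> g \<inter> invariants X \<phi> h. 1 / real (card (stabilizer G \<phi> x)))"

abbreviation words :: "nat \<Rightarrow> nat \<Rightarrow> (nat \<Rightarrow> nat) set" where
  "words k n \<equiv> {1..n} \<rightarrow>\<^sub>E {1..k}"

definition word_action :: "nat \<Rightarrow> nat \<Rightarrow> (nat \<Rightarrow> nat) \<Rightarrow> (nat \<Rightarrow> nat) \<Rightarrow> (nat \<Rightarrow> nat)" where
  "word_action k n g = (\<lambda>x \<in> words k n. x \<circ> inv' g)"

lemma word_action_in_words:
  assumes "g permutes {1..n}" "x \<in> words k n"
  shows "x \<circ> inv' g \<in> words k n"
proof (rule PiE_I)
  have p: "inv' g permutes {1..n}"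
    using assms(1) by (rule permutes_inv)
  show "(x \<circ> inv' g) i \<in> {1..k}" if "i \<in> {1..n}" for i
    using that p assms(2) by (metis PiE_mem comp_apply permutes_in_image)
  show "(x \<circ> inv' g) i = undefined" if "i \<notin> {1..n}" for i
    using that p assms(2) by (metis PiE_arb comp_apply permutes_not_in)
qed

lemma group_action_word_action:
  "group_action (sym_group n) (words k n) (word_action k n)"
proof -
  have bij: "word_action k n g \<in> Bij (words k n)" if g: "g permutes {1..n}" for g
  proof -
    have gi: "inv' g permutes {1..n}"
      using g by (rule permutes_inv)
    have "bij_betw (word_action k n g) (words k n) (words k n)"
    proof (rule bij_betw_byWitness[where f' = "\<lambda>x. x \<circ> g"])
      show "\<forall>x\<in>words k n. word_action k n g x \<circ> g = x"
        using g by (auto simp: word_action_def comp_assoc permutes_inv_o)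
      show "\<forall>x\<in>words k n. word_action k n g (x \<circ> g) = x"
      proof
        fix x assume x: "x \<in> words k n"
        have "x \<circ> g \<in> words k n"
          using word_action_in_words[OF gi x] g by (simp add: inv_inv_eq permutes_bij)
        then show "word_action k n g (x \<circ> g) = x"
          using g by (simp add: word_action_def comp_assoc permutes_inv_o)
      qed
      show "word_action k n g ` words k n \<subseteq> words k n"
        by (rule image_subsetI)
          (simp only: word_action_def restrict_apply' word_action_in_words[OF g])
      show "(\<lambda>x. x \<circ> g) ` words k n \<subseteq> words k n"
      proof (rule image_subsetI)
        fix x assume "x \<in> words k n"
        then show "x \<circ> g \<in> words k n"
          using word_action_in_words[OF gi] g by (metis inv_inv_eq permutes_bij)
      qed
    qed
    then show ?thesis
      by (simp add: Bij_def word_action_def)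
  qed
  have "word_action k n (g \<circ> h) = compose (words k n) (word_action k n g) (word_action k n h)"
    if "g permutes {1..n}" "h permutes {1..n}" for g h
  proof
    fix x
    show "word_action k n (g \<circ> h) x =
        compose (words k n) (word_action k n g) (word_action k n h) x"
    proof (cases "x \<in> words k n")
      case True
      have "inv' (g \<circ> h) = inv' h \<circ> inv' g"
        using that by (simp add: o_inv_distrib permutes_bij)
      then show ?thesis
        using True word_action_in_words[OF that(2) True]
        by (simp only: word_action_def compose_def restrict_apply' comp_assoc)
    next
      case False
      then show ?thesis
        by (simp only: word_action_def compose_def restrict_apply if_False)
    qed
  qed
  then have "word_action k n \<in> hom (sym_group n) (BijGroup (words k n))"
    using bij by (auto simp: hom_def sym_group_carrier sym_group_mult BijGroup_def)
  then show ?thesis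
    by (simp add: group_action_def group_hom_def group_hom_axioms_def
        sym_group_is_group group_BijGroup)
qed

definition generated_orbits :: "nat \<Rightarrow> (nat \<Rightarrow> nat) set \<Rightarrow> nat set set" where
  "generated_orbits n S =
     orbits ((sym_group n)\<lparr>carrier := generate (sym_group n) S\<rparr>) {1..n} (\<lambda>p. p)"

definition num_cycles :: "nat \<Rightarrow> (nat \<Rightarrow> nat) \<Rightarrow> nat" where
  "num_cycles n g = card (Orbits.orbit g ` {1..n})"

definition class_mass :: "nat \<Rightarrow> (nat \<Rightarrow> nat) \<Rightarrow> (nat \<Rightarrow> nat) \<Rightarrow> nat \<Rightarrow> nat" where
  "class_mass s b \<phi> a = (\<Sum>j \<in> {j \<in> {1..s}. \<phi> j = a}. b j)"

definition multinomial :: "nat \<Rightarrow> nat \<Rightarrow> (nat \<Rightarrow> nat) \<Rightarrow> real" where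
  "multinomial n k m = fact n / (\<Prod>a=1..k. fact (m a))"

text \<open>
  A monomial in variables \<open>z\<^sub>a\<close> (\<open>a :: nat\<close>) is its integer exponent vector, of type
  \<open>nat \<Rightarrow>\<^sub>0 int\<close>. Laurent polynomials are finitely supported maps from monomials to coefficients
  (with the convolution product of \<^theory>\<open>HOL-Library.Poly_Mapping\<close>); formal series are arbitrary
  such maps.
\<close>

type_synonym laurent_poly = "(nat \<Rightarrow>\<^sub>0 int) \<Rightarrow>\<^sub>0 real"
type_synonym formal_series = "(nat \<Rightarrow>\<^sub>0 int) \<Rightarrow> real"

definition zpow :: "nat \<Rightarrow> int \<Rightarrow> laurent_poly" where
  "zpow a m = Poly_Mapping.single (Poly_Mapping.single a m) 1"

definition const_term :: "formal_series \<Rightarrow> real" where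
  "const_term F = F 0"

text \<open>
  The exponential is \<open>\<Sum>m. p ^ m / m!\<close>, taken coefficientwise. For \<open>p = z\<^sub>1 + \<dots> + z\<^sub>k\<close> each
  coefficient receives a contribution from at most one \<open>m\<close>.
\<close>

definition formal_exp :: "laurent_poly \<Rightarrow> formal_series" where
  "formal_exp p = (\<lambda>e. suminf (\<lambda>m. Poly_Mapping.lookup (p ^ m) e / fact m))"

text \<open>
  Formal series do not form a ring, but they are a module over the Laurent polynomials.
\<close>

definition series_times :: "formal_series \<Rightarrow> laurent_poly \<Rightarrow> formal_series" where
  "series_times F p =
     (\<lambda>e. \<Sum>d \<in> Poly_Mapping.keys p. F (e - d) * Poly_Mapping.lookup p d)"

end

theory Submission
  imports Defs
begin

text \<open>
  A word is fixed by \<open>g\<close> and \<open>h\<close> iff it is constant on the orbits of the group they generate, so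
  these words correspond to the maps \<open>\<phi>\<close> from orbits to letters; in the same way \<open>g\<close> alone fixes
  \<open>k ^ c(g)\<close> words. The stabilizer of a word is the product of the symmetric groups on its letter
  classes, which for the word of \<open>\<phi>\<close> have sizes \<open>M\<^sub>a(\<phi>)\<close>. This gives the first formula, and the
  expectation is the same sum over uniform \<open>\<phi>\<close>. For the constant terms, expanding the product over
  the orbits gives \<open>\<Sum>\<^sub>\<phi> \<Prod>\<^sub>a z\<^sub>a ^ (- M\<^sub>a(\<phi>))\<close>, and the coefficient of \<open>\<Prod>\<^sub>a z\<^sub>a ^ M\<^sub>a\<close> in the
  exponential, as well as in its degree \<open>n\<close> part, is \<open>\<Prod>\<^sub>a 1 / M\<^sub>a!\<close>, because \<open>\<Sum>\<^sub>a M\<^sub>a(\<phi>) = n\<close>.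
\<close>

section \<open>Functions constant on fibres and permutations preserving fibres\<close>

text \<open>A function that does not separate points with equal \<open>q\<close> factors uniquely
  through \<open>q\<close>; the inverse evaluates it at a chosen representative of each fibre. This
  serves twice: with the cycles of a single permutation and with the orbits of the group generated
  by two.\<close>

lemma bij_betw_restrict_comp:
  assumes "q ` A = I"
  shows "bij_betw (\<lambda>\<phi>. restrict (\<phi> \<circ> q) A) (I \<rightarrow>\<^sub>E K)
    {x \<in> A \<rightarrow>\<^sub>E K. \<forall>i\<in>A. \<forall>j\<in>A. q i = q j \<longrightarrow> x i = x j}"
proof (rule bij_betw_byWitness[where f' = "\<lambda>x. \<lambda>j\<in>I. x (inv_into A q j)"])
  have inv: "inv_into A q j \<in> A" "q (inv_into A q j) = j" if "j \<in> I" for j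
    using that inv_into_into[of j q A] f_inv_into_f[of j q A] unfolding assms by simp_all
  show "\<forall>\<phi>\<in>I \<rightarrow>\<^sub>E K. (\<lambda>j\<in>I. restrict (\<phi> \<circ> q) A (inv_into A q j)) = \<phi>"
  proof (intro ballI ext)
    fix \<phi> j assume \<phi>: "\<phi> \<in> I \<rightarrow>\<^sub>E K"
    show "(\<lambda>j\<in>I. restrict (\<phi> \<circ> q) A (inv_into A q j)) j = \<phi> j"
      using inv[of j] PiE_arb[OF \<phi>, of j] by simp
  qed
  show "\<forall>x\<in>{x \<in> A \<rightarrow>\<^sub>E K. \<forall>i\<in>A. \<forall>j\<in>A. q i = q j \<longrightarrow> x i = x j}.
      restrict ((\<lambda>j\<in>I. x (inv_into A q j)) \<circ> q) A = x"
  proof (intro ballI ext)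
    fix x i
    assume x: "x \<in> {x \<in> A \<rightarrow>\<^sub>E K. \<forall>i\<in>A. \<forall>j\<in>A. q i = q j \<longrightarrow> x i = x j}"
    show "restrict ((\<lambda>j\<in>I. x (inv_into A q j)) \<circ> q) A i = x i"
    proof (cases "i \<in> A")
      case True
      then have "q i \<in> I" using assms by blast
      with True inv[of "q i"] x have "x (inv_into A q (q i)) = x i" by blast
      with True \<open>q i \<in> I\<close> show ?thesis by simp
    next
      case False
      moreover from x have "x \<in> A \<rightarrow>\<^sub>E K" by blast
      ultimately show ?thesis using PiE_arb[of x A "\<lambda>_. K" i] by simp
    qed
  qed
  show "(\<lambda>\<phi>. restrict (\<phi> \<circ> q) A) ` (I \<rightarrow>\<^sub>E K)
      \<subseteq> {x \<in> A \<rightarrow>\<^sub>E K. \<forall>i\<in>A. \<forall>j\<in>A. q i = q j \<longrightarrow> x i = x j}"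
    using assms by (auto intro!: PiE_I)
  show "(\<lambda>x. \<lambda>j\<in>I. x (inv_into A q j)) `
      {x \<in> A \<rightarrow>\<^sub>E K. \<forall>i\<in>A. \<forall>j\<in>A. q i = q j \<longrightarrow> x i = x j} \<subseteq> I \<rightarrow>\<^sub>E K"
    using inv by (auto intro!: PiE_I)
qed

text \<open>Such a permutation maps every fibre of \<open>x\<close> to itself, and permutations of
  the fibres can be chosen independently and glued. A value in \<open>K\<close> that
  \<open>x\<close> does not take has an empty fibre and contributes the factor 0! = 1.\<close>

lemma card_permutes_preserving:
  assumes fin: "finite A" "finite K" and x: "x ` A \<subseteq> K"
  shows "card {p. p permutes A \<and> (\<forall>i\<in>A. x (p i) = x i)} = (\<Prod>a\<in>K. fact (card {i \<in> A. x i = a}))"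
proof -
  define B where "B a = {i \<in> A. x i = a}" for a
  \<comment> \<open>\<open>?F\<close> cuts \<open>p\<close> into its fibre parts, each extended by
    the identity as \<open>permutes\<close> demands. \<open>?G\<close> glues by applying at
    \<open>i\<close> the part that belongs to the fibre of \<open>i\<close>.\<close>
  let ?F = "\<lambda>p. \<lambda>a\<in>K. \<lambda>i. if i \<in> B a then p i else i"
  let ?G = "\<lambda>q i. if i \<in> A then q (x i) i else i"
  let ?S = "{p. p permutes A \<and> (\<forall>i\<in>A. x (p i) = x i)}"
  let ?T = "\<Pi>\<^sub>E a\<in>K. {q. q permutes B a}"
  have "bij_betw ?F ?S ?T"
  proof (rule bij_betw_byWitness[where f' = ?G])
    show "\<forall>p\<in>?S. ?G (?F p) = p"
    proof (intro ballI ext)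
      fix p i assume p: "p \<in> ?S"
      show "?G (?F p) i = p i"
      proof (cases "i \<in> A")
        case True
        with x have "x i \<in> K" by blast
        with True show ?thesis by (simp add: B_def)
      next
        case False
        with p permutes_not_in[of p A i] show ?thesis by simp
      qed
    qed
    show "\<forall>q\<in>?T. ?F (?G q) = q"
    proof (intro ballI ext)
      fix q a i
      assume q: "q \<in> ?T"
      show "?F (?G q) a i = q a i"
      proof (cases "a \<in> K")
        case True
        with q have "q a permutes B a" by (auto simp: PiE_iff)
        with True show ?thesis by (auto simp: B_def dest: permutes_not_in)
      next
        case False
        with PiE_arb[OF q False] show ?thesis by simp
      qed
    qed
    show "?F ` ?S \<subseteq> ?T"
    proof (intro image_subsetI PiE_I)
      fix p a
      assume p: "p \<in> ?S" and "a \<in> K"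
      have "bij_betw (\<lambda>i. if i \<in> B a then p i else i) (B a) (B a)"
      proof -
        have inj: "inj_on p (B a)"
          using p by (auto intro: inj_on_subset[OF permutes_inj])
        have "p ` B a \<subseteq> B a"
          using p by (auto simp: B_def permutes_in_image)
        moreover have "finite (B a)" using fin by (simp add: B_def)
        ultimately have "p ` B a = B a"
          using inj by (simp add: endo_inj_surj)
        with inj have "bij_betw p (B a) (B a)" by (simp add: bij_betw_def)
        then show ?thesis by (simp cong: bij_betw_cong)
      qed
      then have "(\<lambda>i. if i \<in> B a then p i else i) permutes B a"
        by (rule bij_imp_permutes) simp
      with \<open>a \<in> K\<close> show "?F p a \<in> {q. q permutes B a}" by simp
    qed simp
    show "?G ` ?T \<subseteq> ?S"
    proof (rule image_subsetI)
      fix q assume q: "q \<in> ?T"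
      have qp: "q a permutes B a" if "a \<in> K" for a using q that by (auto simp: PiE_iff)
      have qB: "q (x i) i \<in> A" "x (q (x i) i) = x i" if "i \<in> A" for i
      proof -
        have "q (x i) i \<in> B (x i)"
          using qp[of "x i"] x that by (subst permutes_in_image) (auto simp: B_def)
        then show "q (x i) i \<in> A" "x (q (x i) i) = x i" by (auto simp: B_def)
      qed
      have "inj_on (?G q) A"
      proof (rule inj_onI)
        fix i j assume ij: "i \<in> A" "j \<in> A" "?G q i = ?G q j"
        then have "q (x i) i = q (x j) j" by simp
        \<comment> \<open>Each part stays in its own fibre, so equal images come from the same fibre
          and hence from the same injective part.\<close>
        moreover from this have "x i = x j" using qB ij by metis
        moreover have "inj (q (x i))" using qp x ij by (auto intro: permutes_inj)
        ultimately show "i = j" by (simp add: inj_eq)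
      qed
      moreover from this have "?G q ` A = A"
        using fin(1) qB by (intro endo_inj_surj) auto
      ultimately have "bij_betw (?G q) A A"
        by (simp only: bij_betw_def simp_thms)
      then have "?G q permutes A" by (rule bij_imp_permutes) simp
      with qB show "?G q \<in> ?S" by simp
    qed
  qed
  then have "card ?S = card ?T" by (rule bij_betw_same_card)
  also have "\<dots> = (\<Prod>a\<in>K. fact (card (B a)))"
    using fin by (simp add: card_PiE card_permutations B_def)
  finally show ?thesis by (simp add: B_def)
qed

section \<open>Fixed words and stabilizers of the action on words\<close>

text \<open>Composing with \<open>g\<close> on the right removes the inverse from the action;
  outside \<open>{1..n}\<close> the equation is trivial because \<open>g\<close> is the identity
  there.\<close>

lemma word_action_eq_iff:
  assumes g: "g permutes {1..n}" and x: "x \<in> words k n"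
  shows "word_action k n g x = x \<longleftrightarrow> (\<forall>i\<in>{1..n}. x (g i) = x i)"
proof -
  have "word_action k n g x = x \<longleftrightarrow> x \<circ> inv' g = x"
    using x by (simp add: word_action_def)
  also have "\<dots> \<longleftrightarrow> x \<circ> g = x"
    using permutes_inv_o[OF g] by (metis comp_assoc comp_id)
  also have "\<dots> \<longleftrightarrow> (\<forall>i\<in>{1..n}. x (g i) = x i)"
    using permutes_not_in[OF g] by (fastforce simp: fun_eq_iff)
  finally show ?thesis .
qed

text \<open>The stabilizer is the Young subgroup of the letter classes of \<open>x\<close>.\<close>

lemma card_stabilizer_word_action:
  assumes x: "x \<in> words k n"
  shows "card (stabilizer (sym_group n) (word_action k n) x)
    = (\<Prod>a=1..k. fact (card {i \<in> {1..n}. x i = a}))"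
proof -
  have "stabilizer (sym_group n) (word_action k n) x
      = {p. p permutes {1..n} \<and> (\<forall>i\<in>{1..n}. x (p i) = x i)}"
    using word_action_eq_iff[OF _ x] by (auto simp: stabilizer_def sym_group_carrier)
  with x show ?thesis
    by (simp add: card_permutes_preserving[where K = "{1..k}"] image_subset_iff PiE_iff)
qed

text \<open>Being fixed by \<open>g\<close> means being constant on its cycles, so a fixed word is a
  free choice of one letter per cycle.\<close>

lemma card_invariants_word_action:
  assumes g: "g permutes {1..n}"
  shows "card (invariants (words k n) (word_action k n) g) = k ^ num_cycles n g"
proof -
  let ?o = "Orbits.orbit g"
  have perm: "permutation g" using g by (auto intro: permutes_imp_permutation)
  have "(\<forall>i\<in>{1..n}. x (g i) = x i) \<longleftrightarrow>
      (\<forall>i\<in>{1..n}. \<forall>j\<in>{1..n}. ?o i = ?o j \<longrightarrow> x i = x j)" for x :: "nat \<Rightarrow> nat"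
  proof (intro iffI ballI impI)
    fix i j
    assume x: "\<forall>i\<in>{1..n}. x (g i) = x i" and ij: "i \<in> {1..n}" "?o i = ?o j"
    \<comment> \<open>Extended to all \<open>i\<close>, so that the induction along the orbit need
      not carry membership in \<open>{1..n}\<close>.\<close>
    have xg: "x (g i) = x i" for i
      using x permutes_not_in[OF g] by metis
    have "x l = x i" if "l \<in> ?o i" for l using that by induction (simp_all add: xg)
    moreover have "j \<in> ?o i" using ij permutation_self_in_orbit[OF perm] by metis
    ultimately show "x i = x j" by simp
  next
    fix i
    assume x: "\<forall>i\<in>{1..n}. \<forall>j\<in>{1..n}. ?o i = ?o j \<longrightarrow> x i = x j" and i: "i \<in> {1..n}"
    moreover have "g i \<in> {1..n}" using i permutes_in_image[OF g] by blast
    moreover have "?o (g i) = ?o i" using perm by (rule permutation_orbit_step)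
    ultimately show "x (g i) = x i" by blast
  qed
  then have "invariants (words k n) (word_action k n) g
      = {x \<in> words k n. \<forall>i\<in>{1..n}. \<forall>j\<in>{1..n}. ?o i = ?o j \<longrightarrow> x i = x j}"
    by (simp only: invariants_def word_action_eq_iff[OF g] cong: conj_cong)
  then show ?thesis
    using bij_betw_same_card[OF bij_betw_restrict_comp[OF refl, of ?o "{1..n}" "{1..k}"]]
    by (simp add: card_PiE num_cycles_def)
qed

text \<open>A word fixed by \<open>g\<close> and \<open>h\<close> is fixed by everything they
  generate, hence is constant on orbits. The map \<open>q\<close>, sending a point to the index of
  its orbit, brings this condition into the shape that \<open>bij_betw_restrict_comp\<close>
  expects.\<close>

lemma invariants_word_action_generated_orbits:
  assumes g: "g permutes {1..n}" and h: "h permutes {1..n}"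
    and bij: "bij_betw Orb J (generated_orbits n {g, h})"
  obtains q where "q ` {1..n} = J" "\<And>j. j \<in> J \<Longrightarrow> Orb j = {i \<in> {1..n}. q i = j}"
    "invariants (words k n) (word_action k n) g \<inter> invariants (words k n) (word_action k n) h
      = {x \<in> words k n. \<forall>i\<in>{1..n}. \<forall>j\<in>{1..n}. q i = q j \<longrightarrow> x i = x j}"
proof -
  interpret group "sym_group n" by (rule sym_group_is_group)
  define H where "H = generate (sym_group n) {g, h}"
  define ob where "ob i = {p i | p. p \<in> H}" for i
  have sub: "{g, h} \<subseteq> carrier (sym_group n)" using g h by (simp add: sym_group_carrier)
  have H: "subgroup H (sym_group n)" unfolding H_def by (rule generate_is_subgroup[OF sub])
  have permH: "p permutes {1..n}" if "p \<in> H" for p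
    using subgroup.mem_carrier[OF H that] by (simp add: sym_group_carrier)
  have idH: "id \<in> H" using subgroup.one_closed[OF H] by (simp add: sym_group_one)
  have compH: "p \<circ> p' \<in> H" if "p \<in> H" "p' \<in> H" for p p'
    using subgroup.m_closed[OF H that] by (simp add: sym_group_mult)
  have invH: "inv' p \<in> H" if "p \<in> H" for p
    using subgroup.m_inv_closed[OF H that] subgroup.mem_carrier[OF H that] by simp
  have ob_img: "generated_orbits n {g, h} = ob ` {1..n}"
    by (auto simp: generated_orbits_def orbits_def Group_Action.orbit_def ob_def H_def)
  have self: "i \<in> ob i" for i unfolding ob_def using idH by (intro CollectI exI[of _ id]) simp
  have mono: "ob (p i) \<subseteq> ob i" if "p \<in> H" for p i
  proof
    fix l assume "l \<in> ob (p i)"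
    then obtain p' where "p' \<in> H" "l = (p' \<circ> p) i" by (auto simp: ob_def)
    with compH[OF _ that] show "l \<in> ob i" unfolding ob_def by blast
  qed
  \<comment> \<open>The reverse inclusion is \<open>mono\<close> for the inverse of \<open>p\<close>
    at the point \<open>p i\<close>.\<close>
  have same: "ob (p i) = ob i" if "p \<in> H" for p i
  proof
    have "inv' p (p i) = i" using permutes_inverses(2)[OF permH[OF that]] by simp
    with mono[OF invH[OF that], of "p i"] show "ob i \<subseteq> ob (p i)" by simp
  qed (rule mono[OF that])
  have ob_eq: "ob i = ob j \<longleftrightarrow> i \<in> ob j" for i j
  proof
    assume "i \<in> ob j"
    then show "ob i = ob j" using same by (auto simp: ob_def[of j])
  qed (use self in blast)
  have ob_sub: "ob i \<subseteq> {1..n}" if "i \<in> {1..n}" for i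
    using that permutes_in_image[OF permH] unfolding ob_def by blast
  have fixed: "(\<forall>i\<in>{1..n}. x (g i) = x i) \<and> (\<forall>i\<in>{1..n}. x (h i) = x i) \<longleftrightarrow>
      (\<forall>i\<in>{1..n}. \<forall>j\<in>{1..n}. ob i = ob j \<longrightarrow> x i = x j)" for x :: "nat \<Rightarrow> nat"
  proof safe
    fix i j
    assume x: "\<forall>i\<in>{1..n}. x (g i) = x i" "\<forall>i\<in>{1..n}. x (h i) = x i" and ij: "ob i = ob j"
    have xg: "x (f i) = x i" if "f \<in> {g, h}" for f i
      using x that permutes_not_in[OF g] permutes_not_in[OF h] by (metis insertE singletonD)
    have "\<forall>i. x (p i) = x i" if "p \<in> H" for p
      using that unfolding H_def
    proof (induction rule: generate.induct)
      case (inv f)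
      then have f: "f permutes {1..n}" using g h by auto
      show ?case
      proof
        fix i
        \<comment> \<open>Invariance under an inverse generator is invariance under the generator at
          the preimage of \<open>i\<close>.\<close>
        have "x (f (inv' f i)) = x (inv' f i)" using xg inv by blast
        then show "x ((inv\<^bsub>sym_group n\<^esub> f) i) = x i"
          using f permutes_inverses(1)[OF f] by (simp add: sym_group_carrier)
      qed
    qed (use xg in \<open>auto simp: sym_group_one sym_group_mult\<close>)
    moreover obtain p where "p \<in> H" "i = p j"
      using ij self[of i] by (auto simp: ob_def)
    ultimately show "x i = x j" by simp
  next
    fix i
    assume x: "\<forall>i\<in>{1..n}. \<forall>j\<in>{1..n}. ob i = ob j \<longrightarrow> x i = x j" and i: "i \<in> {1..n}"
    have "x (f i) = x i" if f: "f \<in> {g, h}" for f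
    proof -
      have "f \<in> H" unfolding H_def using f by (rule generate.incl)
      then have "ob (f i) = ob i" "f i \<in> {1..n}"
        using same permH i by (auto simp: permutes_in_image simp del: atLeastAtMost_iff)
      with x i show ?thesis by blast
    qed
    then show "x (g i) = x i" "x (h i) = x i" by auto
  qed
  define q where "q i = inv_into J Orb (ob i)" for i
  have Orb_q: "Orb (q i) = ob i" "q i \<in> J" if "i \<in> {1..n}" for i
    using that bij ob_img unfolding q_def bij_betw_def
    by (auto intro!: f_inv_into_f inv_into_into simp del: atLeastAtMost_iff)
  have q_eq: "q i = q j \<longleftrightarrow> ob i = ob j" if "i \<in> {1..n}" "j \<in> {1..n}" for i j
    using Orb_q that by (metis q_def)
  have q_Orb: "q i = j" if "i \<in> {1..n}" "j \<in> J" "Orb j = ob i" for i j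
    using Orb_q[OF that(1)] that bij by (auto simp: bij_betw_def inj_on_def)
  have obtain_ob: "\<exists>i\<in>{1..n}. Orb j = ob i" if "j \<in> J" for j
  proof -
    have "Orb j \<in> ob ` {1..n}"
      using bij_betw_imp_surj_on[OF bij] that unfolding ob_img by (metis imageI)
    then show ?thesis by blast
  qed
  show thesis
  proof
    show "q ` {1..n} = J"
      using Orb_q q_Orb obtain_ob by (fastforce simp del: atLeastAtMost_iff)
    show "Orb j = {i \<in> {1..n}. q i = j}" if j: "j \<in> J" for j
    proof -
      from obtain_ob[OF j] obtain i where i: "i \<in> {1..n}" "Orb j = ob i" by blast
      then have "l \<in> ob i \<longleftrightarrow> l \<in> {1..n} \<and> q l = j" for l
        using ob_sub[OF i(1)] q_Orb[OF i(1) j i(2)] q_eq[OF _ i(1), of l] ob_eq[of l i] by auto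
      with i show ?thesis by auto
    qed
    show "invariants (words k n) (word_action k n) g \<inter> invariants (words k n) (word_action k n) h
      = {x \<in> words k n. \<forall>i\<in>{1..n}. \<forall>j\<in>{1..n}. q i = q j \<longrightarrow> x i = x j}"
    proof (rule Set.set_eqI)
      fix x :: "nat \<Rightarrow> nat"
      have "(\<forall>i\<in>{1..n}. \<forall>j\<in>{1..n}. q i = q j \<longrightarrow> x i = x j) \<longleftrightarrow>
          (\<forall>i\<in>{1..n}. \<forall>j\<in>{1..n}. ob i = ob j \<longrightarrow> x i = x j)"
        using q_eq by blast
      then show "x \<in> invariants (words k n) (word_action k n) g \<inter>
            invariants (words k n) (word_action k n) h \<longleftrightarrow>
          x \<in> {x \<in> words k n. \<forall>i\<in>{1..n}. \<forall>j\<in>{1..n}. q i = q j \<longrightarrow> x i = x j}"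
        using fixed[of x] word_action_eq_iff[OF g, of x k] word_action_eq_iff[OF h, of x k]
        unfolding invariants_def Int_iff mem_Collect_eq by argo
    qed
  qed
qed

text \<open>The fibres of \<open>q\<close> whose label goes to \<open>a\<close> partition the
  positions where the word \<open>\<phi> \<circ> q\<close> has the letter \<open>a\<close>. This
  identifies the orbit masses with the class sizes in the stabilizer formula.\<close>

lemma class_mass_card:
  fixes q :: "nat \<Rightarrow> nat"
  assumes q: "q ` {1..n} = {1..s}" and b: "\<And>j. j \<in> {1..s} \<Longrightarrow> b j = card {i \<in> {1..n}. q i = j}"
  shows "class_mass s b \<phi> a = card {i \<in> {1..n}. \<phi> (q i) = a}"
proof -
  have "{i \<in> {1..n}. \<phi> (q i) = a} = (\<Union>j\<in>{j \<in> {1..s}. \<phi> j = a}. {i \<in> {1..n}. q i = j})"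
    using q by blast
  moreover have "card (\<Union>j\<in>{j \<in> {1..s}. \<phi> j = a}. {i \<in> {1..n}. q i = j}) = (\<Sum>j | j \<in> {1..s} \<and> \<phi> j = a. card {i \<in> {1..n}. q i = j})"
  proof (rule card_UN_disjoint)
    show "\<forall>j\<in>{j \<in> {1..s}. \<phi> j = a}. finite {i \<in> {1..n}. q i = j}"
      by (intro ballI finite_subset[OF _ finite_atLeastAtMost[of 1 n]]) blast
  qed auto
  ultimately show ?thesis using b by (simp add: class_mass_def)
qed

text \<open>Composition with the orbit labelling \<open>q\<close> reindexes the sum over common
  fixed words by maps from orbits to letters. The second claim, that the orbits partition
  \<open>{1..n}\<close>, is what later fixes the degree of the relevant monomials.\<close>

lemma dual_burnside_word_action:
  assumes g: "g permutes {1..n}" and h: "h permutes {1..n}"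
    and bij: "bij_betw Orb {1..s} (generated_orbits n {g, h})"
    and b: "\<And>j. j \<in> {1..s} \<Longrightarrow> b j = card (Orb j)"
  shows "dual_burnside (sym_group n) (words k n) (word_action k n) g h =
    1 / real k ^ num_cycles n g *
    (\<Sum>\<phi> \<in> {1..s} \<rightarrow>\<^sub>E {1..k}. \<Prod>a=1..k. 1 / fact (class_mass s b \<phi> a))"
    and "(\<Sum>j=1..s. b j) = n"
proof -
  obtain q where q: "q ` {1..n} = {1..s}" "\<And>j. j \<in> {1..s} \<Longrightarrow> Orb j = {i \<in> {1..n}. q i = j}"
    and inv: "invariants (words k n) (word_action k n) g \<inter> invariants (words k n) (word_action k n) h
      = {x \<in> words k n. \<forall>i\<in>{1..n}. \<forall>j\<in>{1..n}. q i = q j \<longrightarrow> x i = x j}"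
    by (rule invariants_word_action_generated_orbits[OF g h bij, of k]) (rule that)
  have b': "b j = card {i \<in> {1..n}. q i = j}" if "j \<in> {1..s}" for j
    using b q(2) that by simp
  have cm: "class_mass s b \<phi> a = card {i \<in> {1..n}. \<phi> (q i) = a}" for \<phi> a
    by (rule class_mass_card[OF q(1) b'])
  \<comment> \<open>A constant map puts all orbits into one class, whose positions are all of
    \<open>{1..n}\<close>.\<close>
  have "(\<Sum>j=1..s. b j) = class_mass s b (\<lambda>_. 0) 0" unfolding class_mass_def by (intro sum.cong) auto
  with cm[where \<phi> = "\<lambda>_. 0" and a = 0] show "(\<Sum>j=1..s. b j) = n"
    by (simp del: atLeastAtMost_iff)
  have "(\<Sum>x \<in> invariants (words k n) (word_action k n) g \<inter> invariants (words k n) (word_action k n) h.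
        1 / real (card (stabilizer (sym_group n) (word_action k n) x)))
      = (\<Sum>\<phi> \<in> {1..s} \<rightarrow>\<^sub>E {1..k}.
          1 / real (card (stabilizer (sym_group n) (word_action k n) (restrict (\<phi> \<circ> q) {1..n}))))"
    unfolding inv by (rule sum.reindex_bij_betw[OF bij_betw_restrict_comp[OF q(1)], symmetric])
  also have "\<dots> = (\<Sum>\<phi> \<in> {1..s} \<rightarrow>\<^sub>E {1..k}. \<Prod>a=1..k. 1 / fact (class_mass s b \<phi> a))"
  proof (rule sum.cong[OF refl])
    fix \<phi> assume "\<phi> \<in> {1..s} \<rightarrow>\<^sub>E {1..k}"
    then have w: "restrict (\<phi> \<circ> q) {1..n} \<in> words k n"
      using bij_betwE[OF bij_betw_restrict_comp[OF q(1), of "{1..k}"]] by blast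
    have "{i \<in> {1..n}. restrict (\<phi> \<circ> q) {1..n} i = a} = {i \<in> {1..n}. \<phi> (q i) = a}" for a
      by auto
    with w show "1 / real (card (stabilizer (sym_group n) (word_action k n) (restrict (\<phi> \<circ> q) {1..n})))
        = (\<Prod>a=1..k. 1 / fact (class_mass s b \<phi> a))"
      by (simp add: card_stabilizer_word_action cm prod_dividef del: restrict_apply)
  qed
  finally show "dual_burnside (sym_group n) (words k n) (word_action k n) g h =
    1 / real k ^ num_cycles n g *
    (\<Sum>\<phi> \<in> {1..s} \<rightarrow>\<^sub>E {1..k}. \<Prod>a=1..k. 1 / fact (class_mass s b \<phi> a))"
    unfolding dual_burnside_def card_invariants_word_action[OF g] of_nat_power by (simp only:)
qed

section \<open>Coefficients of Laurent polynomials and of the exponential\<close>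

text \<open>Multiplication by a monomial shifts exponents. Integer exponent vectors form a group, so
  \<open>e - d\<close> makes sense without a divisibility condition.\<close>

lemma lookup_single_times:
  fixes p :: laurent_poly
  shows "Poly_Mapping.lookup (Poly_Mapping.single d c * p) e = c * Poly_Mapping.lookup p (e - d)"
proof -
  have sub: "e = l + q \<longleftrightarrow> q = e - l" for l q :: "nat \<Rightarrow>\<^sub>0 int"
    by (auto simp: algebra_simps)
  have "Poly_Mapping.lookup (Poly_Mapping.single d c * p) e
      = (\<Sum>l. (c when d = l) * Poly_Mapping.lookup p (e - l))"
    by (simp add: lookup_mult lookup_single sub)
  also have "\<dots> = (\<Sum>l. c * Poly_Mapping.lookup p (e - l) when l = d)"
    by (rule Sum_any.cong) (auto simp: when_def)
  finally show ?thesis by simp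
qed

lemma series_times_sum_single:
  assumes "finite I"
  shows "series_times F (\<Sum>i\<in>I. Poly_Mapping.single (d i) (c i)) e = (\<Sum>i\<in>I. F (e - d i) * c i)"
proof -
  let ?p = "\<Sum>i\<in>I. Poly_Mapping.single (d i) (c i)"
  have "Poly_Mapping.keys ?p \<subseteq> d ` I"
    by (rule order.trans[OF keys_sum]) (auto split: if_splits)
  then have "series_times F ?p e = (\<Sum>l\<in>d ` I. F (e - l) * Poly_Mapping.lookup ?p l)"
    unfolding series_times_def using assms
    by (intro sum.mono_neutral_left) (auto simp: in_keys_iff)
  also have "\<dots> = (\<Sum>l\<in>d ` I. \<Sum>i\<in>I. if d i = l then F (e - d i) * c i else 0)"
    by (intro sum.cong) (auto simp: lookup_sum lookup_single when_def sum_distrib_left intro!: sum.cong)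
  also have "\<dots> = (\<Sum>i\<in>I. \<Sum>l\<in>d ` I. if d i = l then F (e - d i) * c i else 0)"
    by (rule sum.swap)
  also have "\<dots> = (\<Sum>i\<in>I. F (e - d i) * c i)"
    using assms by (intro sum.cong) auto
  finally show ?thesis .
qed

text \<open>These are the coefficients of the product of the series exp(z_a) for a = 1, ..., k; the
  value 0 covers exponent vectors that are negative somewhere or involve another variable.\<close>

definition exp_coeff :: "nat \<Rightarrow> (nat \<Rightarrow>\<^sub>0 int) \<Rightarrow> real" where
  "exp_coeff k e =
    (if (\<forall>a. 0 \<le> Poly_Mapping.lookup e a) \<and> (\<forall>a. a \<notin> {1..k} \<longrightarrow> Poly_Mapping.lookup e a = 0)
     then \<Prod>a=1..k. 1 / fact (nat (Poly_Mapping.lookup e a)) else 0)"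

text \<open>
  Summed over \<open>a\<close>, the factors \<open>e\<^sub>a\<close> add up to the total degree; this drives the induction on the
  exponent \<open>m\<close> below.
\<close>

lemma exp_coeff_diff_single:
  assumes a: "a \<in> {1..k}"
  shows "exp_coeff k (e - Poly_Mapping.single a 1) = of_int (Poly_Mapping.lookup e a) * exp_coeff k e"
proof -
  let ?e' = "e - Poly_Mapping.single a 1"
  let ?ok = "\<lambda>e. (\<forall>a. (0 :: int) \<le> Poly_Mapping.lookup e a) \<and>
    (\<forall>a. a \<notin> {1..k} \<longrightarrow> Poly_Mapping.lookup e a = 0)"
  have l: "Poly_Mapping.lookup ?e' c = Poly_Mapping.lookup e c - (if c = a then 1 else 0)" for c
    by (simp add: lookup_minus lookup_single when_def)
  have ok_iff: "?ok ?e' \<longleftrightarrow> ?ok e \<and> Poly_Mapping.lookup e a \<ge> 1"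
    using a unfolding l by (auto split: if_splits; force)
  show ?thesis
  proof (cases "?ok e \<and> Poly_Mapping.lookup e a \<ge> 1")
    case True
    let ?P = "\<lambda>e A. \<Prod>c\<in>A. 1 / (fact (nat (Poly_Mapping.lookup e c)) :: real)"
    have rest: "?P ?e' ({1..k} - {a}) = ?P e ({1..k} - {a})"
      by (rule prod.cong) (auto simp: l)
    obtain m where m: "Poly_Mapping.lookup e a = int (Suc m)"
      using True by (metis One_nat_def nat_le_iff int_nat_eq not0_implies_Suc int_ops(2)
          nonneg_int_cases of_nat_le_iff not_one_le_zero)
    have "?P ?e' {1..k} = 1 / fact m * ?P e ({1..k} - {a})"
      using a m by (subst prod.remove[of _ a]) (simp_all add: l rest)
    moreover have "?P e {1..k} = 1 / fact (Suc m) * ?P e ({1..k} - {a})"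
      using a m by (subst prod.remove[of _ a]) (simp_all add: l nat_add_distrib)
    ultimately have "?P ?e' {1..k} = real (Suc m) * ?P e {1..k}"
      by simp
    with True ok_iff m show ?thesis by (simp add: exp_coeff_def)
  next
    case False
    \<comment> \<open>Either \<open>e\<close> is itself inadmissible or its exponent at
      \<open>a\<close> is 0; both sides of the claim vanish in either case.\<close>
    then have "Poly_Mapping.lookup e a = 0 \<or> exp_coeff k e = 0"
      unfolding exp_coeff_def by (smt (verit))
    moreover have "exp_coeff k ?e' = 0" using False ok_iff unfolding exp_coeff_def by argo
    ultimately show ?thesis by auto
  qed
qed

text \<open>This is the multinomial theorem in coefficient form: the m-th power over m! is the
  degree \<open>m\<close> part of the exponential. It thus serves both constant term
  formulas.\<close>

lemma lookup_power_sum_zpow: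
  "Poly_Mapping.lookup ((\<Sum>a=1..k. zpow a 1) ^ m) e / fact m
    = (if (\<Sum>a=1..k. Poly_Mapping.lookup e a) = int m then exp_coeff k e else 0)"
proof (induction m arbitrary: e)
  case 0
  show ?case
  proof (cases "e = 0")
    case True
    then show ?thesis by (simp add: exp_coeff_def lookup_one)
  next
    case False
    then obtain c where c: "Poly_Mapping.lookup e c \<noteq> 0" by (auto simp: poly_mapping_eq_iff fun_eq_iff)
    \<comment> \<open>Nonnegative exponents with sum 0 all vanish, so a nonzero \<open>e\<close> of
      degree 0 is inadmissible.\<close>
    have "exp_coeff k e = 0" if "(\<Sum>a=1..k. Poly_Mapping.lookup e a) = 0"
    proof (rule ccontr)
      assume "exp_coeff k e \<noteq> 0"
      then have ok: "\<forall>a. 0 \<le> Poly_Mapping.lookup e a" "\<forall>a. a \<notin> {1..k} \<longrightarrow> Poly_Mapping.lookup e a = 0"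
        unfolding exp_coeff_def by argo+
      then have "\<forall>a\<in>{1..k}. Poly_Mapping.lookup e a = 0"
        using that by (subst (asm) sum_nonneg_eq_0_iff) auto
      with ok c show False by blast
    qed
    with False show ?thesis by (simp add: lookup_one)
  qed
next
  case (Suc m)
  let ?p = "\<Sum>a=1..k. zpow a 1"
  let ?S = "\<lambda>e. \<Sum>a=1..k. (Poly_Mapping.lookup e a :: int)"
  have S: "?S (e - Poly_Mapping.single a 1) = ?S e - 1" if "a \<in> {1..k}" for a
    using that by (simp add: lookup_minus lookup_single when_def sum_subtractf)
  have "Poly_Mapping.lookup (?p ^ Suc m) e
      = (\<Sum>a=1..k. Poly_Mapping.lookup (?p ^ m) (e - Poly_Mapping.single a 1))"
    by (simp add: sum_distrib_right lookup_sum zpow_def lookup_single_times)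
  then have "Poly_Mapping.lookup (?p ^ Suc m) e / fact (Suc m)
      = (\<Sum>a=1..k. Poly_Mapping.lookup (?p ^ m) (e - Poly_Mapping.single a 1) / fact m) / real (Suc m)"
    by (simp add: sum_divide_distrib mult.commute)
  also have "\<dots> = (\<Sum>a=1..k. if ?S e = int (Suc m) then of_int (Poly_Mapping.lookup e a) * exp_coeff k e else 0)
      / real (Suc m)"
    unfolding Suc.IH by (intro arg_cong2[where f = "(/)"] refl sum.cong)
      (use S exp_coeff_diff_single in auto)
  also have "\<dots> = (if ?S e = int (Suc m) then of_int (?S e) * exp_coeff k e / real (Suc m) else 0)"
    by (simp flip: sum_distrib_right of_int_sum)
  finally show ?case by simp
qed

lemma formal_exp_sum_zpow:
  "formal_exp (\<Sum>a=1..k. zpow a 1) e = exp_coeff k e"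
proof -
  let ?S = "\<Sum>a=1..k. Poly_Mapping.lookup e a"
  \<comment> \<open>\<open>nat\<close> sends a negative degree to 0, so the coefficient must vanish
    there for the series to reduce to its term at \<open>nat ?S\<close>.\<close>
  have "exp_coeff k e = 0" if "?S < 0"
    using that sum_nonneg[of "{1..k}" "Poly_Mapping.lookup e"] unfolding exp_coeff_def by (smt (verit))
  then have "(if ?S = int m then exp_coeff k e else 0) = (if m = nat ?S then exp_coeff k e else 0)" for m
    by auto
  then show ?thesis
    using sums_single[of "nat ?S" "\<lambda>_. exp_coeff k e"]
    unfolding formal_exp_def lookup_power_sum_zpow by (simp add: sums_iff)
qed

section \<open>Constant terms and orbit masses\<close>

text \<open>The exponent vector with entries M_a. Summing over orbits rather than letters lets it
  match the expansion of the product over orbits factor by factor.\<close>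

definition mass_vector :: "nat \<Rightarrow> (nat \<Rightarrow> nat) \<Rightarrow> (nat \<Rightarrow> nat) \<Rightarrow> (nat \<Rightarrow>\<^sub>0 int)" where
  "mass_vector s b \<phi> = (\<Sum>j=1..s. Poly_Mapping.single (\<phi> j) (int (b j)))"

lemma lookup_mass_vector:
  "Poly_Mapping.lookup (mass_vector s b \<phi>) a = int (class_mass s b \<phi> a)"
  by (simp add: mass_vector_def class_mass_def lookup_sum lookup_single when_def sum.inter_filter
      of_nat_sum if_distrib[of int] del: atLeastAtMost_iff cong: if_cong)

text \<open>Masses are nonnegative and live on the letters \<open>{1..k}\<close>, so the zero branch
  of \<open>exp_coeff\<close> is never taken.\<close>

lemma exp_coeff_mass_vector:
  assumes "\<phi> \<in> {1..s} \<rightarrow>\<^sub>E {1..k}"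
  shows "exp_coeff k (mass_vector s b \<phi>) = (\<Prod>a=1..k. 1 / fact (class_mass s b \<phi> a))"
proof -
  have "class_mass s b \<phi> a = 0" if "a \<notin> {1..k}" for a
    using assms that unfolding class_mass_def by (intro sum.neutral) (auto simp: PiE_iff)
  then show ?thesis by (simp add: exp_coeff_def lookup_mass_vector)
qed

lemma sum_class_mass:
  assumes "\<phi> \<in> {1..s} \<rightarrow>\<^sub>E {1..k}"
  shows "(\<Sum>a=1..k. class_mass s b \<phi> a) = (\<Sum>j=1..s. b j)"
  unfolding class_mass_def using assms
  by (intro sum.group) (auto simp: PiE_iff)

text \<open>By distributivity, choosing a summand in every factor is choosing a map
  \<open>\<phi>\<close>, and the chosen monomials multiply by adding exponents.\<close>

lemma prod_sum_zpow:
  "(\<Prod>j=1..s. \<Sum>a=1..k. zpow a (- int (b j)))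
    = (\<Sum>\<phi> \<in> {1..s} \<rightarrow>\<^sub>E {1..k}. Poly_Mapping.single (- mass_vector s b \<phi>) 1)"
proof -
  have "(\<Prod>j\<in>J. zpow (\<phi> j) (- int (b j)))
      = Poly_Mapping.single (- (\<Sum>j\<in>J. Poly_Mapping.single (\<phi> j) (int (b j)))) 1"
    if "finite J" for J :: "nat set" and \<phi>
    using that
  proof induction
    case (insert j J)
    then show ?case
      by (simp add: zpow_def mult_single single_uminus)
  qed simp
  then show ?thesis
    by (simp add: prod_sum_PiE mass_vector_def)
qed

text \<open>A monomial with exponent vector \<open>- mass_vector s b \<phi>\<close> moves the
  coefficient of the exponential at \<open>mass_vector s b \<phi>\<close> into the constant
  term.\<close>

lemma const_term_exp:
  "const_term (series_times (formal_exp (\<Sum>a=1..k. zpow a 1))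
      (\<Prod>j=1..s. \<Sum>a=1..k. zpow a (- int (b j))))
    = (\<Sum>\<phi> \<in> {1..s} \<rightarrow>\<^sub>E {1..k}. \<Prod>a=1..k. 1 / fact (class_mass s b \<phi> a))"
  unfolding const_term_def prod_sum_zpow
  by (subst series_times_sum_single)
    (auto simp: finite_PiE formal_exp_sum_zpow[unfolded One_nat_def] exp_coeff_mass_vector intro!: sum.cong)

text \<open>The masses of every \<open>\<phi>\<close> add up to \<open>n\<close>, so the degree
  \<open>n\<close> part of the exponential already contains all the coefficients that are read
  off.\<close>

lemma const_term_power:
  assumes "(\<Sum>j=1..s. b j) = n"
  shows "const_term (Poly_Mapping.lookup
      (Poly_Mapping.single 0 (1 / fact n) * (\<Sum>a=1..k. zpow a 1) ^ n *
        (\<Prod>j=1..s. \<Sum>a=1..k. zpow a (- int (b j)))))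
    = (\<Sum>\<phi> \<in> {1..s} \<rightarrow>\<^sub>E {1..k}. \<Prod>a=1..k. 1 / fact (class_mass s b \<phi> a))"
proof -
  let ?p = "\<Sum>a=1..k. zpow a 1"
  have "const_term (Poly_Mapping.lookup (Poly_Mapping.single 0 (1 / fact n) * ?p ^ n *
        (\<Prod>j=1..s. \<Sum>a=1..k. zpow a (- int (b j)))))
      = (\<Sum>\<phi> \<in> {1..s} \<rightarrow>\<^sub>E {1..k}. Poly_Mapping.lookup (?p ^ n) (mass_vector s b \<phi>) / fact n)"
    unfolding const_term_def prod_sum_zpow
    by (subst mult.commute)
      (simp add: sum_distrib_right lookup_sum lookup_single_times)
  also have "\<dots> = (\<Sum>\<phi> \<in> {1..s} \<rightarrow>\<^sub>E {1..k}. \<Prod>a=1..k. 1 / fact (class_mass s b \<phi> a))"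
  proof (rule sum.cong[OF refl])
    fix \<phi> assume \<phi>: "\<phi> \<in> {1..s} \<rightarrow>\<^sub>E {1..k}"
    have "(\<Sum>a=1..k. Poly_Mapping.lookup (mass_vector s b \<phi>) a) = int n"
      using sum_class_mass[OF \<phi>, of b] assms by (simp add: lookup_mass_vector flip: of_nat_sum)
    with \<phi> show "Poly_Mapping.lookup (?p ^ n) (mass_vector s b \<phi>) / fact n
        = (\<Prod>a=1..k. 1 / fact (class_mass s b \<phi> a))"
      unfolding lookup_power_sum_zpow by (simp add: exp_coeff_mass_vector)
  qed
  finally show ?thesis .
qed

section \<open>Expectations over independent uniform labels\<close>

text \<open>Almost surely all labels lie in \<open>K\<close>, so the integrand is a finite sum of
  the values \<open>f \<phi>\<close> times indicators of the events that the labels equal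
  \<open>\<phi>\<close>. By independence and uniformity these events are equally likely.\<close>

lemma (in prob_space) expectation_indep_uniform:
  fixes U :: "'i \<Rightarrow> 'a \<Rightarrow> 'b" and f :: "('i \<Rightarrow> 'b) \<Rightarrow> real"
  assumes indep: "indep_vars (\<lambda>_. count_space UNIV) U I" and I: "finite I" "I \<noteq> {}"
    and K: "finite K" "K \<noteq> {}"
    and unif: "\<And>j. j \<in> I \<Longrightarrow> distr M (count_space UNIV) (U j) = measure_pmf (pmf_of_set K)"
    and meas: "(\<lambda>\<omega>. f (\<lambda>j. U j \<omega>)) \<in> borel_measurable M"
    and f: "\<And>x y. (\<And>j. j \<in> I \<Longrightarrow> x j = y j) \<Longrightarrow> f x = f y"
  shows "expectation (\<lambda>\<omega>. f (\<lambda>j. U j \<omega>)) = (\<Sum>\<phi> \<in> I \<rightarrow>\<^sub>E K. f \<phi>) / card K ^ card I"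
proof -
  have U: "U j \<in> measurable M (count_space UNIV)" if "j \<in> I" for j
    using indep that by (auto simp: indep_vars_def)
  have pr: "prob (U j -` B \<inter> space M) = measure_pmf.prob (pmf_of_set K) B" if "j \<in> I" for j B
    using measure_distr[OF U[OF that], of B] unif[OF that] by simp
  \<comment> \<open>For empty \<open>I\<close> this intersection would be the whole type rather than
    \<open>space M\<close>, which is why \<open>I\<close> is nonempty.\<close>
  let ?E = "\<lambda>\<phi>. \<Inter>j\<in>I. U j -` {\<phi> j} \<inter> space M"
  have E: "?E \<phi> \<in> events" for \<phi>
    using I U by (intro sets.finite_INT measurable_sets[OF U]) auto
  have prE: "prob (?E \<phi>) = 1 / card K ^ card I" if "\<phi> \<in> I \<rightarrow>\<^sub>E K" for \<phi>
  proof -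
    have "prob (?E \<phi>) = (\<Prod>j\<in>I. prob (U j -` {\<phi> j} \<inter> space M))"
      using I by (intro indep_varsD[OF indep]) auto
    also have "\<dots> = (\<Prod>j\<in>I. 1 / card K)"
      using that K by (intro prod.cong) (auto simp: pr measure_pmf_single PiE_iff)
    finally show ?thesis by (simp add: power_one_over)
  qed
  have "AE \<omega> in M. U j \<omega> \<in> K" if "j \<in> I" for j
  proof -
    have "AE u in distr M (count_space UNIV) (U j). u \<in> K"
      unfolding unif[OF that] using K by (auto simp: AE_measure_pmf_iff)
    then show ?thesis using U[OF that] by (subst (asm) AE_distr_iff) auto
  qed
  then have "AE \<omega> in M. \<forall>j\<in>I. U j \<omega> \<in> K"
    using I by (intro AE_finite_allI) auto
  then have "AE \<omega> in M. f (\<lambda>j. U j \<omega>) = (\<Sum>\<phi> \<in> I \<rightarrow>\<^sub>E K. f \<phi> * indicator (?E \<phi>) \<omega>)"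
    using AE_space
  proof eventually_elim
    case (elim \<omega>)
    let ?u = "\<lambda>j\<in>I. U j \<omega>"
    have u: "?u \<in> I \<rightarrow>\<^sub>E K" using elim by auto
    have ind: "indicator (?E \<phi>) \<omega> = (if \<phi> = ?u then 1 else (0::real))" if "\<phi> \<in> I \<rightarrow>\<^sub>E K" for \<phi>
    proof -
      have "\<omega> \<in> ?E \<phi> \<longleftrightarrow> (\<forall>j\<in>I. U j \<omega> = \<phi> j)"
        using elim(2) I(2) by simp
      also have "\<dots> \<longleftrightarrow> \<phi> = ?u"
        using PiE_ext[OF that u] by (auto simp: restrict_def)
      finally show ?thesis by (simp add: indicator_def)
    qed
    have "(\<Sum>\<phi> \<in> I \<rightarrow>\<^sub>E K. f \<phi> * indicator (?E \<phi>) \<omega>) = (\<Sum>\<phi> \<in> I \<rightarrow>\<^sub>E K. if \<phi> = ?u then f \<phi> else 0)"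
    proof (rule sum.cong[OF refl])
      fix \<phi> assume "\<phi> \<in> I \<rightarrow>\<^sub>E K"
      then show "f \<phi> * indicator (?E \<phi>) \<omega> = (if \<phi> = ?u then f \<phi> else 0)"
        by (subst ind) auto
    qed
    also have "\<dots> = f ?u"
      using I K u by (simp add: finite_PiE)
    \<comment> \<open>\<open>?u\<close> agrees with the labels on \<open>I\<close> only, and
      \<open>f\<close> depends on nothing else.\<close>
    also have "\<dots> = f (\<lambda>j. U j \<omega>)" by (rule f) simp
    finally show ?case ..
  qed
  then have "expectation (\<lambda>\<omega>. f (\<lambda>j. U j \<omega>))
      = expectation (\<lambda>\<omega>. \<Sum>\<phi> \<in> I \<rightarrow>\<^sub>E K. f \<phi> * indicator (?E \<phi>) \<omega>)"
    using E by (intro integral_cong_AE[OF meas] borel_measurable_sum borel_measurable_times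
      borel_measurable_const borel_measurable_indicator)
  also have "\<dots> = (\<Sum>\<phi> \<in> I \<rightarrow>\<^sub>E K. f \<phi> * prob (?E \<phi>))"
  proof (subst Bochner_Integration.integral_sum)
    show "integrable M (\<lambda>\<omega>. f \<phi> * indicator (?E \<phi>) \<omega>)" for \<phi>
      by (intro integrable_mult_right integrable_real_indicator E) (simp add: less_top[symmetric])
    show "(\<Sum>\<phi> \<in> I \<rightarrow>\<^sub>E K. expectation (\<lambda>\<omega>. f \<phi> * indicator (?E \<phi>) \<omega>))
        = (\<Sum>\<phi> \<in> I \<rightarrow>\<^sub>E K. f \<phi> * prob (?E \<phi>))"
      by (simp only: integral_mult_right_zero Bochner_Integration.integral_indicator sets.Int_space_eq2[OF E])
  qed
  also have "\<dots> = (\<Sum>\<phi> \<in> I \<rightarrow>\<^sub>E K. f \<phi>) / card K ^ card I"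
    by (simp only: sum_divide_distrib) (rule sum.cong[OF refl], simp only: prE, simp)
  finally show ?thesis .
qed

section \<open>The five expressions for the dual Burnside kernel\<close>

theorem theorem5p3:
  fixes k n s :: nat and g h :: "nat \<Rightarrow> nat" and Orb :: "nat \<Rightarrow> nat set" and b :: "nat \<Rightarrow> nat"
  assumes "k \<ge> 1" and "n \<ge> 1"
    and "g \<in> carrier (sym_group n)" and "h \<in> carrier (sym_group n)"
    and "bij_betw Orb {1..s} (generated_orbits n {g, h})"
    and "\<And>j. j \<in> {1..s} \<Longrightarrow> b j = card (Orb j)"
  shows
    "dual_burnside (sym_group n) (words k n) (word_action k n) g h =
       1 / real k ^ num_cycles n g *
       (\<Sum>\<phi> \<in> {1..s} \<rightarrow>\<^sub>E {1..k}. \<Prod>a=1..k. 1 / fact (class_mass s b \<phi> a))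
     \<and>
     dual_burnside (sym_group n) (words k n) (word_action k n) g h =
       real k powi (- int (num_cycles n g)) / fact n *
       (\<Sum>\<phi> \<in> {1..s} \<rightarrow>\<^sub>E {1..k}. multinomial n k (class_mass s b \<phi>))
     \<and>
     (\<forall>(P :: 'w measure) (U :: nat \<Rightarrow> 'w \<Rightarrow> nat).
        prob_space P \<and>
        prob_space.indep_vars P (\<lambda>_. count_space UNIV) U {1..s} \<and>
        (\<forall>j\<in>{1..s}. distr P (count_space UNIV) (U j) = measure_pmf (pmf_of_set {1..k}))
        \<longrightarrow>
        dual_burnside (sym_group n) (words k n) (word_action k n) g h =
          real k powi (int s - int (num_cycles n g)) *
          prob_space.expectation P
            (\<lambda>\<omega>. \<Prod>a=1..k. 1 / fact (\<Sum>j=1..s. b j * of_bool (U j \<omega> = a))))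
     \<and>
     dual_burnside (sym_group n) (words k n) (word_action k n) g h =
       1 / real k ^ num_cycles n g *
       const_term (series_times (formal_exp (\<Sum>a=1..k. zpow a 1))
         (\<Prod>j=1..s. \<Sum>a=1..k. zpow a (- int (b j))))
     \<and>
     dual_burnside (sym_group n) (words k n) (word_action k n) g h =
       real k powi (- int (num_cycles n g)) *
       const_term (Poly_Mapping.lookup
         (Poly_Mapping.single 0 (1 / fact n) * (\<Sum>a=1..k. zpow a 1) ^ n *
          (\<Prod>j=1..s. \<Sum>a=1..k. zpow a (- int (b j)))))"
proof (intro conjI allI impI)
  let ?Q = "dual_burnside (sym_group n) (words k n) (word_action k n) g h"
  let ?W = "\<Sum>\<phi> \<in> {1..s} \<rightarrow>\<^sub>E {1..k}. \<Prod>a=1..k. 1 / (fact (class_mass s b \<phi> a) :: real)"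
  have g: "g permutes {1..n}" and h: "h permutes {1..n}"
    using assms(3,4) by (simp_all add: sym_group_carrier)
  have Q: "?Q = 1 / real k ^ num_cycles n g * ?W"
    by (rule dual_burnside_word_action(1)[OF g h assms(5,6)])
  have mass: "(\<Sum>j=1..s. b j) = n"
    by (rule dual_burnside_word_action(2)[OF g h assms(5,6)])
  have pow: "real k powi (- int c) = 1 / real k ^ c" for c
    by (simp add: power_int_minus inverse_eq_divide)
  show "?Q = 1 / real k ^ num_cycles n g * ?W"
    by (rule Q)
  have "(\<Sum>\<phi> \<in> {1..s} \<rightarrow>\<^sub>E {1..k}. multinomial n k (class_mass s b \<phi>)) = fact n * ?W"
    by (simp add: multinomial_def sum_distrib_left prod_dividef)
  then show "?Q = real k powi (- int (num_cycles n g)) / fact n *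
      (\<Sum>\<phi> \<in> {1..s} \<rightarrow>\<^sub>E {1..k}. multinomial n k (class_mass s b \<phi>))"
    unfolding Q pow by simp
  show "?Q = 1 / real k ^ num_cycles n g *
      const_term (series_times (formal_exp (\<Sum>a=1..k. zpow a 1))
        (\<Prod>j=1..s. \<Sum>a=1..k. zpow a (- int (b j))))"
    unfolding Q const_term_exp by (rule refl)
  show "?Q = real k powi (- int (num_cycles n g)) *
      const_term (Poly_Mapping.lookup
        (Poly_Mapping.single 0 (1 / fact n) * (\<Sum>a=1..k. zpow a 1) ^ n *
          (\<Prod>j=1..s. \<Sum>a=1..k. zpow a (- int (b j)))))"
    unfolding Q const_term_power[OF mass] pow by (rule refl)
  fix P :: "'w measure" and U :: "nat \<Rightarrow> 'w \<Rightarrow> nat"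
  assume "prob_space P \<and>
    prob_space.indep_vars P (\<lambda>_. count_space UNIV) U {1..s} \<and>
    (\<forall>j\<in>{1..s}. distr P (count_space UNIV) (U j) = measure_pmf (pmf_of_set {1..k}))"
  then have P: "prob_space P" and indep: "prob_space.indep_vars P (\<lambda>_. count_space UNIV) U {1..s}"
    and unif: "\<And>j. j \<in> {1..s} \<Longrightarrow> distr P (count_space UNIV) (U j) = measure_pmf (pmf_of_set {1..k})"
    by blast+
  interpret prob_space P by (rule P)
  let ?f = "\<lambda>u. \<Prod>a=1..k. 1 / (fact (\<Sum>j=1..s. b j * of_bool (u j = a)) :: real)"
  \<comment> \<open>Without orbits the masses would sum to 0, against
    \<open>n \<ge> 1\<close>.\<close>
  have "{1..s} \<noteq> {}"
    using mass assms(2) by (cases s) auto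
  have U [measurable]: "U j \<in> measurable P (count_space UNIV)" if "j \<in> {1..s}" for j
    using indep that by (auto simp: indep_vars_def)
  have "(\<lambda>\<omega>. \<Sum>j=1..s. b j * of_bool (U j \<omega> = a)) \<in> measurable P (count_space UNIV)" for a
    by measurable
  then have meas: "(\<lambda>\<omega>. ?f (\<lambda>j. U j \<omega>)) \<in> borel_measurable P"
    by (intro borel_measurable_prod borel_measurable_divide borel_measurable_const)
      (rule measurable_compose[where N = "count_space UNIV"], auto)
  have "expectation (\<lambda>\<omega>. ?f (\<lambda>j. U j \<omega>))
      = (\<Sum>\<phi> \<in> {1..s} \<rightarrow>\<^sub>E {1..k}. ?f \<phi>) / card {1..k} ^ card {1..s}"
    using assms(1) \<open>{1..s} \<noteq> {}\<close>
    by (intro expectation_indep_uniform[where f = ?f, OF indep _ _ _ _ unif meas])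
      (auto intro!: prod.cong sum.cong arg_cong[where f = fact])
  also have "(\<Sum>\<phi> \<in> {1..s} \<rightarrow>\<^sub>E {1..k}. ?f \<phi>) = ?W"
  proof -
    have "(\<Sum>j=1..s. b j * of_bool (\<phi> j = a)) = class_mass s b \<phi> a" for \<phi> a
      unfolding class_mass_def by (rule sum.mono_neutral_cong_right) auto
    then show ?thesis by simp
  qed
  \<comment> \<open>The factor \<open>k ^ s\<close> undoes the uniform weight of each
    \<open>\<phi>\<close>; splitting the integer power uses that \<open>k\<close> is
    nonzero.\<close>
  finally show "?Q = real k powi (int s - int (num_cycles n g)) *
      expectation (\<lambda>\<omega>. \<Prod>a=1..k. 1 / fact (\<Sum>j=1..s. b j * of_bool (U j \<omega> = a)))"
    using assms(1) unfolding Q by (simp add: power_int_diff)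
qed

end
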